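(* Let assumptions (A1)-(A4) of the context hold and let $\epsilon\in(0,1)$. Put $\Psi_k=\Omega_k$ for all $k\in\{0,\dots,N-1\}$ if the system is asymptotically stable ($d=0$), and $\Psi_k=\Omega_k^\epsilon$ for all $k$ if it is not ($d\ge1$). Let $\Psi_0$ be described by $\Psi_0=\{x\in\mathbb{R}^n: H_0x\le h_0\}$ for a finite-dimensional matrix $H_0$ and vector $h_0$. Then for each $k=1,\dots,N-1$, $\Psi_k$ can be described by $\Psi_k=\{x\in\mathbb{R}^n: H_kx\le h_k\}$, where $$H_k=\begin{bmatrix}S_kC_k\\ S_{k+1}C_{k+1}A_k\\ \vdots\\ S_{N-1}C_{N-1}A_{N-2}\cdots A_k\\ H_0\,(A_{N-1}\cdots A_{k+1}A_k)\end{bmatrix},\qquad h_k=\begin{bmatrix}\mathbf{1}\\ \mathbf{1}\\ \vdots\\ \mathbf{1}\\ h_0\end{bmatrix}.$$ (In particular $H_{N-1}=\begin{bmatrix}S_{N-1}C_{N-1}\\ H_0A_{N-1}\end{bmatrix}$ and $h_{N-1}=\begin{bmatrix}\mathbf{1}\\ h_0\end{bmatrix}$.)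
   Context: Setting. Let $N\ge 1$ be an integer. Consider the discrete-time $N$-periodic system $x(t+1)=A(t)x(t)$, $y(t)=C(t)x(t)$, $t\in\mathbb{Z}^+=\{0,1,2,\dots\}$, with $x(t)\in\mathbb{R}^n$, $y(t)\in\mathbb{R}^p$, real matrices $A(t)\in\mathbb{R}^{n\times n}$, $C(t)\in\mathbb{R}^{p\times n}$, $A(t+N)=A(t)$, $C(t+N)=C(t)$. Write $A_k=A(k)$, $C_k=C(k)$ for $k=0,\dots,N-1$. The output is required to satisfy $y(t)\in\mathbb{Y}_{t \bmod N}$. Vector inequalities are componentwise, and $\mathbf{1}$ is the all-ones vector of appropriate dimension. Lifted matrices: $\Phi=A_{N-1}\cdots A_1A_0$; $C$ is the block column with blocks $C_0,\ C_1A_0,\ \dots,\ C_{N-1}A_{N-2}\cdots A_0$; $S=\mathrm{blockdiag}(S_0,\dots,S_{N-1})$. Assumptions. (A1) There is $d\in\mathbb{Z}^+$ such that for all $k$, $A_k=\begin{bmatrix}A_{k,s}&A_{k,c}\\ \mathbf{0}&I_d\end{bmatrix}$, $C_k=[C_{k,s}\ \ C_{k,c}]$. Consequently $\Phi=\begin{bmatrix}\Phi_s&\Phi_c\\ \mathbf{0}&I_d\end{bmatrix}$, $C=[C_s\ \ C_c]$, partitioned consistently. (A2) All eigenvalues of $\Phi_s$ lie in the open unit disk. (A3) The pair $(C,\Phi)$ is observable. (A4) For each $k$, $\mathbb{Y}_k=\{y\in\mathbb{R}^p: S_ky\le\mathbf{1}\}$ is compact, where $S_k\in\mathbb{R}^{q_k\times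 p}$. Definitions. For $k\in\{0,\dots,N-1\}$, $\Omega_k$ is the set of all $x_0\in\mathbb{R}^n$ such that the solution with $x(k)=x_0$ satisfies $y(t)\in\mathbb{Y}_{t \bmod N}$ for all $t\ge k$. Let $\Gamma=[\mathbf{0}\quad C_s(I-\Phi_s)^{-1}\Phi_c+C_c]$ (zero block with $n-d$ columns), $\Omega_{ss}^\epsilon=\{x_0\in\mathbb{R}^n: S\Gamma x_0\le(1-\epsilon)\mathbf{1}\}$, and $\Omega_k^\epsilon=\Omega_{ss}^\epsilon\cap\Omega_k$. *)

theory Defs
  imports
    "HOL-Analysis.Abstract_Euclidean_Space"
    "Jordan_Normal_Form.Gauss_Jordan_Elimination"
    "Jordan_Normal_Form.Char_Poly"
begin

text \<open>
  Conventions. Since the numbers of states, outputs and constraints are arbitrary natural numbers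
  and occur in block decompositions, vectors and matrices are those of
  \<open>Jordan_Normal_Form\<close>, with explicit carriers \<open>carrier_vec n\<close> and \<open>carrier_mat m n\<close>.
  There, \<open>v \<le> w\<close> is the componentwise order (and includes equality of dimensions).
  Throughout, \<open>N\<close> is the period, \<open>n\<close> the state dimension, \<open>p\<close> the output dimension, and
  \<open>d\<close> the dimension of the trailing constant part of the state.
\<close>

definition ones :: "nat \<Rightarrow> real vec" where
  "ones m = vec m (\<lambda>_. 1)"

text \<open>\<open>transition n A k t\<close> is the product \<open>A (t-1) * \<dots> * A (k+1) * A k\<close>, the identity if \<open>t \<le> k\<close>.\<close>

definition transition :: "nat \<Rightarrow> (nat \<Rightarrow> real mat) \<Rightarrow> nat \<Rightarrow> nat \<Rightarrow> real mat" where
  "transition n A k t = foldl (\<lambda>M i. A i * M) (1\<^sub>m n) [k..<t]"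

definition lifted_state :: "nat \<Rightarrow> nat \<Rightarrow> (nat \<Rightarrow> real mat) \<Rightarrow> real mat" where
  "lifted_state N n A = transition n A 0 N"

definition lifted_output :: "nat \<Rightarrow> nat \<Rightarrow> (nat \<Rightarrow> real mat) \<Rightarrow> (nat \<Rightarrow> real mat) \<Rightarrow> real mat" where
  "lifted_output N n A C =
     foldr (@\<^sub>r) (map (\<lambda>j. C j * transition n A 0 j) [0..<N]) (0\<^sub>m 0 n)"

definition lifted_constraint :: "nat \<Rightarrow> (nat \<Rightarrow> real mat) \<Rightarrow> real mat" where
  "lifted_constraint N S = diag_block_mat (map S [0..<N])"

text \<open>The blocks of a partition of an \<open>n\<close>-column matrix into its first \<open>n - d\<close> and last \<open>d\<close>
  columns; for the state matrix only the first \<open>n - d\<close> rows are kept.\<close>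

definition Phi_s :: "nat \<Rightarrow> nat \<Rightarrow> nat \<Rightarrow> (nat \<Rightarrow> real mat) \<Rightarrow> real mat" where
  "Phi_s N n d A =
     (case split_block (lifted_state N n A) (n - d) (n - d) of (M1, M2, M3, M4) \<Rightarrow> M1)"

definition Phi_c :: "nat \<Rightarrow> nat \<Rightarrow> nat \<Rightarrow> (nat \<Rightarrow> real mat) \<Rightarrow> real mat" where
  "Phi_c N n d A =
     (case split_block (lifted_state N n A) (n - d) (n - d) of (M1, M2, M3, M4) \<Rightarrow> M2)"

definition C_s ::
  "nat \<Rightarrow> nat \<Rightarrow> nat \<Rightarrow> (nat \<Rightarrow> real mat) \<Rightarrow> (nat \<Rightarrow> real mat) \<Rightarrow> real mat" where
  "C_s N n d A C = (let L = lifted_output N n A C in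
     case split_block L (dim_row L) (n - d) of (M1, M2, M3, M4) \<Rightarrow> M1)"

definition C_c ::
  "nat \<Rightarrow> nat \<Rightarrow> nat \<Rightarrow> (nat \<Rightarrow> real mat) \<Rightarrow> (nat \<Rightarrow> real mat) \<Rightarrow> real mat" where
  "C_c N n d A C = (let L = lifted_output N n A C in
     case split_block L (dim_row L) (n - d) of (M1, M2, M3, M4) \<Rightarrow> M2)"

text \<open>The block row \<open>[0  X]\<close>, where the zero block has \<open>n - d\<close> columns, is written as a
  four-block matrix whose lower blocks have no rows. The inverse is used only when it exists:
  all eigenvalues of \<open>Phi_s\<close> are assumed to lie in the open unit disk.\<close>

definition Gamma ::
  "nat \<Rightarrow> nat \<Rightarrow> nat \<Rightarrow> (nat \<Rightarrow> real mat) \<Rightarrow> (nat \<Rightarrow> real mat) \<Rightarrow> real mat" where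
  "Gamma N n d A C =
     (let X = C_s N n d A C * the (mat_inverse (1\<^sub>m (n - d) - Phi_s N n d A)) * Phi_c N n d A
              + C_c N n d A C
      in four_block_mat (0\<^sub>m (dim_row X) (n - d)) X (0\<^sub>m 0 (n - d)) (0\<^sub>m 0 d))"

definition extended_by_identity :: "nat \<Rightarrow> nat \<Rightarrow> real mat \<Rightarrow> bool" where
  "extended_by_identity n d M \<longleftrightarrow>
     (\<exists>Ms \<in> carrier_mat (n - d) (n - d). \<exists>Mc \<in> carrier_mat (n - d) d.
        M = four_block_mat Ms Mc (0\<^sub>m d (n - d)) (1\<^sub>m d))"

text \<open>Eigenvalues of a real matrix are its complex eigenvalues.\<close>

definition eigenvalues_in_unit_disk :: "real mat \<Rightarrow> bool" where
  "eigenvalues_in_unit_disk M \<longleftrightarrow>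
     (\<forall>z. eigenvalue (map_mat complex_of_real M) z \<longrightarrow> cmod z < 1)"

text \<open>Observability of \<open>x(t+1) = F x(t)\<close>, \<open>y(t) = G x(t)\<close>: initial states are determined by
  the output sequences they generate.\<close>

definition observable :: "nat \<Rightarrow> real mat \<Rightarrow> real mat \<Rightarrow> bool" where
  "observable n G F \<longleftrightarrow>
     (\<forall>x \<in> carrier_vec n. \<forall>x' \<in> carrier_vec n.
        (\<forall>t::nat. G *\<^sub>v ((F ^\<^sub>m t) *\<^sub>v x) = G *\<^sub>v ((F ^\<^sub>m t) *\<^sub>v x')) \<longrightarrow> x = x')"

text \<open>The type of vectors carries no topology, so compactness of a subset of \<open>carrier_vec p\<close> is
  taken in \<open>Euclidean_space p\<close>, whose points are the sequences vanishing from index \<open>p\<close> on.\<close>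

definition compact_vecs :: "nat \<Rightarrow> real vec set \<Rightarrow> bool" where
  "compact_vecs p Y \<longleftrightarrow>
     compactin (Euclidean_space p) ((\<lambda>v i. if i < p then v $ i else 0) ` Y)"

definition output_set :: "nat \<Rightarrow> real mat \<Rightarrow> real vec set" where
  "output_set p M = {y \<in> carrier_vec p. M *\<^sub>v y \<le> ones (dim_row M)}"

text \<open>Only the values \<open>x t\<close> with \<open>t \<ge> k\<close> matter.\<close>

definition solution_from :: "(nat \<Rightarrow> real mat) \<Rightarrow> nat \<Rightarrow> real vec \<Rightarrow> (nat \<Rightarrow> real vec) \<Rightarrow> bool" where
  "solution_from A k x0 x \<longleftrightarrow> x k = x0 \<and> (\<forall>t\<ge>k. x (t + 1) = A t *\<^sub>v x t)"

definition Omega ::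
  "nat \<Rightarrow> nat \<Rightarrow> nat \<Rightarrow> (nat \<Rightarrow> real mat) \<Rightarrow> (nat \<Rightarrow> real mat) \<Rightarrow> (nat \<Rightarrow> real mat) \<Rightarrow> nat \<Rightarrow> real vec set"
  where
  "Omega N n p A C S k =
     {x0 \<in> carrier_vec n. \<exists>x. solution_from A k x0 x \<and>
        (\<forall>t\<ge>k. C t *\<^sub>v x t \<in> output_set p (S (t mod N)))}"

definition Omega_ss ::
  "nat \<Rightarrow> nat \<Rightarrow> nat \<Rightarrow> (nat \<Rightarrow> real mat) \<Rightarrow> (nat \<Rightarrow> real mat) \<Rightarrow> (nat \<Rightarrow> real mat) \<Rightarrow> real \<Rightarrow> real vec set"
  where
  "Omega_ss N n d A C S \<epsilon> =
     {x0 \<in> carrier_vec n.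
        (lifted_constraint N S * Gamma N n d A C) *\<^sub>v x0
          \<le> (1 - \<epsilon>) \<cdot>\<^sub>v ones (dim_row (lifted_constraint N S))}"

definition Omega_eps ::
  "nat \<Rightarrow> nat \<Rightarrow> nat \<Rightarrow> nat \<Rightarrow> (nat \<Rightarrow> real mat) \<Rightarrow> (nat \<Rightarrow> real mat) \<Rightarrow> (nat \<Rightarrow> real mat) \<Rightarrow>
   real \<Rightarrow> nat \<Rightarrow> real vec set"
  where
  "Omega_eps N n p d A C S \<epsilon> k = Omega_ss N n d A C S \<epsilon> \<inter> Omega N n p A C S k"

definition Psi ::
  "nat \<Rightarrow> nat \<Rightarrow> nat \<Rightarrow> nat \<Rightarrow> (nat \<Rightarrow> real mat) \<Rightarrow> (nat \<Rightarrow> real mat) \<Rightarrow> (nat \<Rightarrow> real mat) \<Rightarrow>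
   real \<Rightarrow> nat \<Rightarrow> real vec set"
  where
  "Psi N n p d A C S \<epsilon> k =
     (if d = 0 then Omega N n p A C S k else Omega_eps N n p d A C S \<epsilon> k)"

text \<open>The stacked description: blocks \<open>S j * C j * A (j-1) * \<dots> * A k\<close> for \<open>j = k, \<dots>, N - 1\<close>,
  followed by \<open>H0 * A (N-1) * \<dots> * A k\<close>.\<close>

definition H_mat ::
  "nat \<Rightarrow> nat \<Rightarrow> (nat \<Rightarrow> real mat) \<Rightarrow> (nat \<Rightarrow> real mat) \<Rightarrow> (nat \<Rightarrow> real mat) \<Rightarrow> real mat \<Rightarrow> nat \<Rightarrow> real mat"
  where
  "H_mat N n A C S H0 k =
     foldr (@\<^sub>r) (map (\<lambda>j. S j * C j * transition n A k j) [k..<N]) (H0 * transition n A k N)"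

definition h_vec :: "nat \<Rightarrow> (nat \<Rightarrow> real mat) \<Rightarrow> real vec \<Rightarrow> nat \<Rightarrow> real vec" where
  "h_vec N S h0 k = foldr (@\<^sub>v) (map (\<lambda>j. ones (dim_row (S j))) [k..<N]) h0"

end

theory Submission
  imports Defs
begin

text \<open>
  Let the state start at time \<open>k < N\<close>. Its constraints at the times \<open>t \<ge> k\<close> split into those with
  \<open>k \<le> t < N\<close>, which are the first blocks of the stacked inequality, and those with \<open>t \<ge> N\<close>. Time
  \<open>N\<close> is indistinguishable from time \<open>0\<close> by periodicity, so the latter say that the state reached at
  time \<open>N\<close>, the image of the initial state under \<open>A (N-1) * \<dots> * A k\<close>, belongs to \<open>Omega\<close> at index
  \<open>0\<close>. This is the recursion \<open>Omega_unfold_to_period\<close>.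

  The tightened steady-state constraint, imposed for \<open>d \<ge> 1\<close>, fits the same pattern. The left block of \<open>Gamma\<close> is zero, so
  the constraint sees only the last \<open>d\<close> components of the state, and the block form of the state
  matrices makes these constant along solutions. Hence the constraint holds at time \<open>k\<close> if and only
  if it holds at time \<open>N\<close> (\<open>Omega_ss_transition_iff\<close>). Together, the initial state belongs to \<open>Psi\<close> at
  index \<open>k\<close> if and only if the outputs at \<open>k, \<dots>, N - 1\<close> are admissible and the state at time \<open>N\<close>
  belongs to \<open>Psi\<close> at index \<open>0\<close>, and the stacked inequality spells this out with the description of
  \<open>Psi\<close> at index \<open>0\<close> pulled back to time \<open>k\<close>.
\<close>

section \<open>Transition matrices\<close>

lemma transition_self [simp]: "transition n A k k = 1\<^sub>m n"
  by (simp add: transition_def)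

lemma transition_Suc: "k \<le> t \<Longrightarrow> transition n A k (Suc t) = A t * transition n A k t"
  by (simp add: transition_def)

lemma transition_carrier:
  assumes "\<And>t. A t \<in> carrier_mat n n" and "k \<le> t"
  shows "transition n A k t \<in> carrier_mat n n"
  using assms(2)
proof (induction t rule: dec_induct)
  case (step t)
  then show ?case using mult_carrier_mat[OF assms(1)] by (simp add: transition_Suc)
qed simp

lemma transition_compose:
  assumes A: "\<And>t. A t \<in> carrier_mat n n" and "k \<le> s" and "s \<le> t"
  shows "transition n A k t = transition n A s t * transition n A k s"
  using assms(3)
proof (induction t rule: dec_induct)
  case base
  then show ?case using transition_carrier[where A = A, OF A \<open>k \<le> s\<close>] by simp
next
  case (step t)
  then show ?case
    using assoc_mult_mat[OF A transition_carrier[where A = A, OF A \<open>s \<le> t\<close>]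
        transition_carrier[where A = A, OF A \<open>k \<le> s\<close>]] \<open>k \<le> s\<close>
    by (simp add: transition_Suc)
qed

lemma transition_periodic:
  assumes "\<And>t. A (t + N) = A t" and "k \<le> t"
  shows "transition n A (k + N) (t + N) = transition n A k t"
  using assms(2)
proof (induction t rule: dec_induct)
  case (step t)
  then show ?case using assms(1) by (simp add: transition_Suc)
qed simp

section \<open>Admissible initial states\<close>

lemma solution_from_iff_transition:
  assumes A: "\<And>t. A t \<in> carrier_mat n n" and x0: "x0 \<in> carrier_vec n"
  shows "solution_from A k x0 x \<longleftrightarrow> (\<forall>t\<ge>k. x t = transition n A k t *\<^sub>v x0)"
proof
  assume sol: "solution_from A k x0 x"
  have "x t = transition n A k t *\<^sub>v x0" if "k \<le> t" for t
    using that
  proof (induction t rule: dec_induct)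
    case base
    then show ?case using sol x0 by (simp add: solution_from_def)
  next
    case (step t)
    then have "x (Suc t) = A t *\<^sub>v (transition n A k t *\<^sub>v x0)"
      using sol by (simp add: solution_from_def)
    then show ?case
      using step assoc_mult_mat_vec[OF A transition_carrier[where A = A, OF A] x0]
      by (simp add: transition_Suc)
  qed
  then show "\<forall>t\<ge>k. x t = transition n A k t *\<^sub>v x0" by blast
next
  assume x: "\<forall>t\<ge>k. x t = transition n A k t *\<^sub>v x0"
  have "x (t + 1) = A t *\<^sub>v x t" if "k \<le> t" for t
    using that x assoc_mult_mat_vec[OF A transition_carrier[where A = A, OF A that] x0]
    by (simp add: transition_Suc)
  then show "solution_from A k x0 x"
    using x x0 by (simp add: solution_from_def)
qed

lemma Omega_iff_transition:
  assumes A: "\<And>t. A t \<in> carrier_mat n n" and x0: "x0 \<in> carrier_vec n"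
  shows "x0 \<in> Omega N n p A C S k \<longleftrightarrow>
    (\<forall>t\<ge>k. C t *\<^sub>v (transition n A k t *\<^sub>v x0) \<in> output_set p (S (t mod N)))"
  using x0 by (auto simp: Omega_def solution_from_iff_transition[where A = A, OF A x0])

text \<open>By periodicity, the constraints from time \<open>N\<close> on are those of the system restarted at time
  \<open>0\<close> in the state reached at time \<open>N\<close>.\<close>

lemma Omega_unfold_to_period:
  assumes A: "\<And>t. A t \<in> carrier_mat n n"
    and A_periodic: "\<And>t. A (t + N) = A t" and C_periodic: "\<And>t. C (t + N) = C t"
    and "k \<le> N" and x0: "x0 \<in> carrier_vec n"
  shows "x0 \<in> Omega N n p A C S k \<longleftrightarrow>
    (\<forall>t\<in>{k..<N}. C t *\<^sub>v (transition n A k t *\<^sub>v x0) \<in> output_set p (S t)) \<and>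
    transition n A k N *\<^sub>v x0 \<in> Omega N n p A C S 0"
proof -
  let ?x = "transition n A k N *\<^sub>v x0"
  let ?ok = "\<lambda>t. C t *\<^sub>v (transition n A k t *\<^sub>v x0) \<in> output_set p (S (t mod N))"
  have T: "transition n A k N \<in> carrier_mat n n"
    using transition_carrier[where A = A, OF A \<open>k \<le> N\<close>] .
  have restart: "C t *\<^sub>v (transition n A 0 t *\<^sub>v ?x) = C (t + N) *\<^sub>v (transition n A k (t + N) *\<^sub>v x0)"
    for t
  proof -
    have "transition n A k (t + N) = transition n A 0 t * transition n A k N"
      using transition_compose[where A = A, OF A \<open>k \<le> N\<close>, of "t + N"]
        transition_periodic[where A = A, OF A_periodic, of 0 t] by simp
    then show ?thesis
      using assoc_mult_mat_vec[OF transition_carrier[where A = A, OF A] T x0, of 0 t] C_periodic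
      by simp
  qed
  have "x0 \<in> Omega N n p A C S k \<longleftrightarrow> (\<forall>t\<ge>k. ?ok t)"
    using Omega_iff_transition[where A = A, OF A x0] .
  also have "\<dots> \<longleftrightarrow> (\<forall>t\<in>{k..<N}. ?ok t) \<and> (\<forall>t\<ge>N. ?ok t)"
    using \<open>k \<le> N\<close> by (meson atLeastLessThan_iff le_trans not_less)
  also have "(\<forall>t\<ge>N. ?ok t) \<longleftrightarrow> (\<forall>t. ?ok (t + N))"
    by (metis le_add2 le_add_diff_inverse2)
  also have "\<dots> \<longleftrightarrow> ?x \<in> Omega N n p A C S 0"
    using Omega_iff_transition[where A = A, OF A mult_mat_vec_carrier[OF T x0]] restart by simp
  finally show ?thesis by simp
qed

section \<open>The steady-state constraint\<close>

lemma extended_by_identity_fixes_tail: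
  fixes x :: "real vec"
  assumes "extended_by_identity n d M" and "d \<le> n" and "x \<in> carrier_vec n"
    and "n - d \<le> i" and "i < n"
  shows "(M *\<^sub>v x) $ i = x $ i"
proof -
  obtain Ms Mc where Ms: "Ms \<in> carrier_mat (n - d) (n - d)" and Mc: "Mc \<in> carrier_mat (n - d) d"
    and M: "M = four_block_mat Ms Mc (0\<^sub>m d (n - d)) (1\<^sub>m d)"
    using assms(1) by (auto simp: extended_by_identity_def)
  have "M $$ (i, j) = 1\<^sub>m n $$ (i, j)" if "j < n" for j
    using assms that Ms Mc by (auto simp: M)
  then have "row M i = row (1\<^sub>m n) i"
    using assms(2,4,5) Ms Mc by (intro eq_vecI) (auto simp: M)
  moreover have "dim_row M = n" using Ms Mc assms(2) by (simp add: M)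
  ultimately have "(M *\<^sub>v x) $ i = (1\<^sub>m n *\<^sub>v x) $ i"
    using assms(5) by simp
  then show ?thesis using assms(3) by simp
qed

lemma transition_fixes_tail:
  fixes x :: "real vec"
  assumes A: "\<And>t. A t \<in> carrier_mat n n" and "d \<le> n" and "k \<le> t"
    and ext: "\<And>j. k \<le> j \<Longrightarrow> j < t \<Longrightarrow> extended_by_identity n d (A j)"
    and x: "x \<in> carrier_vec n" and i: "n - d \<le> i" "i < n"
  shows "(transition n A k t *\<^sub>v x) $ i = x $ i"
  using assms(3) ext
proof (induction t rule: dec_induct)
  case base
  then show ?case using x by simp
next
  case (step t)
  have T: "transition n A k t \<in> carrier_mat n n"
    using transition_carrier[where A = A, OF A \<open>k \<le> t\<close>] .
  have "transition n A k (Suc t) *\<^sub>v x = A t *\<^sub>v (transition n A k t *\<^sub>v x)"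
    using step.hyps assoc_mult_mat_vec[OF A T x] by (simp add: transition_Suc)
  then show ?case
    using extended_by_identity_fixes_tail[OF _ \<open>d \<le> n\<close> mult_mat_vec_carrier[OF T x] i] step
    by simp
qed

lemma mult_mat_vec_cong_tail:
  fixes M :: "real mat" and x y :: "real vec"
  assumes "M \<in> carrier_mat r n" and "x \<in> carrier_vec n" and "y \<in> carrier_vec n"
    and zero: "\<And>i j. i < r \<Longrightarrow> j < l \<Longrightarrow> j < n \<Longrightarrow> M $$ (i, j) = 0"
    and tail: "\<And>j. l \<le> j \<Longrightarrow> j < n \<Longrightarrow> x $ j = y $ j"
  shows "M *\<^sub>v x = M *\<^sub>v y"
proof (rule eq_vecI)
  fix i assume "i < dim_vec (M *\<^sub>v y)"
  then have i: "i < r" using assms(1) by simp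
  have "M $$ (i, j) * x $ j = M $$ (i, j) * y $ j" if "j < n" for j
    using zero[OF i _ that] tail[OF _ that] by (cases "j < l") simp_all
  then show "(M *\<^sub>v x) $ i = (M *\<^sub>v y) $ i"
    using assms(1-3) i by (auto simp: scalar_prod_def simp del: mult_cancel_left intro!: sum.cong)
qed simp

lemma dim_col_lifted_output:
  assumes "\<And>t. A t \<in> carrier_mat n n"
  shows "dim_col (lifted_output N n A C) = n"
proof -
  have "dim_col (C j * transition n A 0 j) = n" for j
    using transition_carrier[where A = A, OF assms, of 0 j] by simp
  then have "dim_col (foldr (@\<^sub>r) (map (\<lambda>j. C j * transition n A 0 j) js) (0\<^sub>m 0 n)) = n" for js
    by (cases js) (simp_all add: append_rows_def)
  then show ?thesis by (simp add: lifted_output_def)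
qed

text \<open>A matrix sum takes its dimensions from its second summand. Inside \<open>Gamma\<close> this is \<open>C_c\<close>,
  which has the columns of the lifted output from \<open>n - d\<close> on.\<close>

lemma dim_col_Gamma:
  assumes "\<And>t. A t \<in> carrier_mat n n" and "d \<le> n"
  shows "dim_col (Gamma N n d A C) = n"
  using assms(2) dim_col_lifted_output[where A = A, OF assms(1)]
  by (simp add: Gamma_def C_c_def split_block_def Let_def)

lemma Gamma_zero_block:
  assumes "i < dim_row (Gamma N n d A C)" and "j < n - d"
  shows "Gamma N n d A C $$ (i, j) = 0"
  using assms by (simp add: Gamma_def Let_def)

text \<open>The zero columns of \<open>Gamma\<close> hide the part of the state that evolves, and only the constant
  part is left.\<close>

lemma Omega_ss_transition_iff:
  assumes A: "\<And>t. A t \<in> carrier_mat n n" and "d \<le> n" and "k \<le> t"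
    and ext: "\<And>j. k \<le> j \<Longrightarrow> j < t \<Longrightarrow> extended_by_identity n d (A j)"
    and x: "x \<in> carrier_vec n"
  shows "transition n A k t *\<^sub>v x \<in> Omega_ss N n d A C S \<epsilon> \<longleftrightarrow> x \<in> Omega_ss N n d A C S \<epsilon>"
proof -
  let ?G = "Gamma N n d A C"
  let ?M = "lifted_constraint N S * ?G"
  have T: "transition n A k t *\<^sub>v x \<in> carrier_vec n"
    using transition_carrier[where A = A, OF A \<open>k \<le> t\<close>] x by simp
  have G: "dim_col ?G = n"
    using dim_col_Gamma[where A = A, OF A \<open>d \<le> n\<close>] .
  have M: "?M \<in> carrier_mat (dim_row (lifted_constraint N S)) n"
    using G by (intro carrier_matI) simp_all
  have "?M $$ (i, j) = 0" if "i < dim_row (lifted_constraint N S)" "j < n - d" "j < n" for i j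
  proof -
    have "col ?G j = 0\<^sub>v (dim_row ?G)"
      using that G
      by (intro eq_vecI) (simp_all add: Gamma_zero_block)
    then show ?thesis
      using that G by (simp add: scalar_prod_def)
  qed
  then have "?M *\<^sub>v (transition n A k t *\<^sub>v x) = ?M *\<^sub>v x"
    using transition_fixes_tail[where A = A, OF A \<open>d \<le> n\<close> \<open>k \<le> t\<close> ext x]
    by (intro mult_mat_vec_cong_tail[where l = "n - d", OF M T x]) auto
  then show ?thesis using x T by (simp add: Omega_ss_def)
qed

lemma Psi_unfold_to_period:
  assumes A: "\<And>t. A t \<in> carrier_mat n n"
    and A_periodic: "\<And>t. A (t + N) = A t" and C_periodic: "\<And>t. C (t + N) = C t"
    and "d \<le> n" and ext: "\<And>k. k < N \<Longrightarrow> extended_by_identity n d (A k)"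
    and "k \<le> N" and x: "x \<in> carrier_vec n"
  shows "x \<in> Psi N n p d A C S \<epsilon> k \<longleftrightarrow>
    (\<forall>t\<in>{k..<N}. C t *\<^sub>v (transition n A k t *\<^sub>v x) \<in> output_set p (S t)) \<and>
    transition n A k N *\<^sub>v x \<in> Psi N n p d A C S \<epsilon> 0"
  using Omega_unfold_to_period[where A = A and C = C, OF A A_periodic C_periodic \<open>k \<le> N\<close> x]
    Omega_ss_transition_iff[where A = A, OF A \<open>d \<le> n\<close> \<open>k \<le> N\<close> ext x]
  by (auto simp: Psi_def Omega_eps_def)

section \<open>Stacked inequalities\<close>

lemma stacked_le_iff:
  fixes F :: "'i \<Rightarrow> real mat"
  assumes "\<And>j. j \<in> set js \<Longrightarrow> F j \<in> carrier_mat (r j) n"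
    and "\<And>j. j \<in> set js \<Longrightarrow> b j \<in> carrier_vec (r j)"
    and "M \<in> carrier_mat m n" and "h \<in> carrier_vec m" and "x \<in> carrier_vec n"
  shows "foldr (@\<^sub>r) (map F js) M *\<^sub>v x \<le> foldr (@\<^sub>v) (map b js) h \<longleftrightarrow>
    (\<forall>j\<in>set js. F j *\<^sub>v x \<le> b j) \<and> M *\<^sub>v x \<le> h"
  using assms(1,2)
proof (induction js)
  case (Cons j js)
  have "foldr (@\<^sub>r) (map F js) M \<in> carrier_mat (sum_list (map r js) + m) n"
    if "\<And>j. j \<in> set js \<Longrightarrow> F j \<in> carrier_mat (r j) n" for js
    using that
  proof (induction js)
    case Nil
    then show ?case using assms(3) by simp
  next
    case (Cons j js)
    then show ?case
      using carrier_append_rows[of "F j" "r j" n] by (simp add: add.assoc)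
  qed
  then have tail: "foldr (@\<^sub>r) (map F js) M \<in> carrier_mat (sum_list (map r js) + m) n"
    using Cons.prems by simp
  have head: "F j \<in> carrier_mat (r j) n" "b j \<in> carrier_vec (r j)"
    using Cons.prems by auto
  have "foldr (@\<^sub>r) (map F (j # js)) M *\<^sub>v x
      = (F j *\<^sub>v x) @\<^sub>v (foldr (@\<^sub>r) (map F js) M *\<^sub>v x)"
    using mat_mult_append[OF head(1) tail assms(5)] by simp
  then show ?case
    using append_vec_le[OF mult_mat_vec_carrier[OF head(1) assms(5)] head(2)] Cons by simp
qed simp

lemma H_mat_le_h_vec_iff:
  assumes A: "\<And>t. A t \<in> carrier_mat n n" and C: "\<And>t. C t \<in> carrier_mat p n"
    and S: "\<And>k. k < N \<Longrightarrow> S k \<in> carrier_mat (q k) p"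
    and H0: "H0 \<in> carrier_mat m n" and h0: "h0 \<in> carrier_vec m"
    and "k \<le> N" and x: "x \<in> carrier_vec n"
  shows "H_mat N n A C S H0 k *\<^sub>v x \<le> h_vec N S h0 k \<longleftrightarrow>
    (\<forall>t\<in>{k..<N}. C t *\<^sub>v (transition n A k t *\<^sub>v x) \<in> output_set p (S t)) \<and>
    H0 *\<^sub>v (transition n A k N *\<^sub>v x) \<le> h0"
proof -
  note T = transition_carrier[where A = A, OF A]
  have block: "S t * C t * transition n A k t \<in> carrier_mat (q t) n" if "k \<le> t" "t < N" for t
    using S[OF that(2)] C T[OF that(1)] by (intro mult_carrier_mat)
  have "S t * C t * transition n A k t *\<^sub>v x \<le> ones (dim_row (S t)) \<longleftrightarrow>
      C t *\<^sub>v (transition n A k t *\<^sub>v x) \<in> output_set p (S t)" if "k \<le> t" "t < N" for t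
  proof -
    have "S t * C t * transition n A k t *\<^sub>v x = S t *\<^sub>v (C t *\<^sub>v (transition n A k t *\<^sub>v x))"
      using assoc_mult_mat_vec[OF mult_carrier_mat[OF S[OF that(2)] C] T[OF that(1)] x]
        assoc_mult_mat_vec[OF S[OF that(2)] C mult_mat_vec_carrier[OF T[OF that(1)] x]] by simp
    then show ?thesis
      using mult_mat_vec_carrier[OF C mult_mat_vec_carrier[OF T[OF that(1)] x]]
      by (simp add: output_set_def)
  qed
  moreover have "H0 * transition n A k N *\<^sub>v x = H0 *\<^sub>v (transition n A k N *\<^sub>v x)"
    using assoc_mult_mat_vec[OF H0 T[OF \<open>k \<le> N\<close>] x] .
  moreover have "H_mat N n A C S H0 k *\<^sub>v x \<le> h_vec N S h0 k \<longleftrightarrow>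
      (\<forall>t\<in>set [k..<N]. S t * C t * transition n A k t *\<^sub>v x \<le> ones (dim_row (S t))) \<and>
      H0 * transition n A k N *\<^sub>v x \<le> h0"
    unfolding H_mat_def h_vec_def
    using block S H0 h0 x T[OF \<open>k \<le> N\<close>]
    by (intro stacked_le_iff[where r = q and m = m and n = n]) (auto simp: ones_def)
  ultimately show ?thesis by auto
qed

lemma H_mat_last:
  assumes "A (N - 1) \<in> carrier_mat n n" and "C (N - 1) \<in> carrier_mat p n" and "1 \<le> N"
  shows "H_mat N n A C S H0 (N - 1) = (S (N - 1) * C (N - 1)) @\<^sub>r (H0 * A (N - 1))"
proof -
  obtain M where N: "N = Suc M" using assms(3) by (cases N) auto
  have "S M * C M * 1\<^sub>m n = S M * C M"
    using assms(2) N by (intro right_mult_one_mat[of _ "dim_row (S M)"] carrier_matI) simp_all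
  then show ?thesis
    using assms(1) by (simp add: N H_mat_def transition_Suc)
qed

lemma h_vec_last: "1 \<le> N \<Longrightarrow> h_vec N S h0 (N - 1) = ones (dim_row (S (N - 1))) @\<^sub>v h0"
  by (cases N) (simp_all add: h_vec_def)

section \<open>Inequality descriptions at all times of a period\<close>

theorem corollary1:
  fixes N n p d m :: nat
    and q :: "nat \<Rightarrow> nat"
    and A C S :: "nat \<Rightarrow> real mat"
    and \<epsilon> :: real
    and H0 :: "real mat"
    and h0 :: "real vec"
  assumes N: "1 \<le> N"
    and A_dim: "\<And>t. A t \<in> carrier_mat n n"
    and C_dim: "\<And>t. C t \<in> carrier_mat p n"
    and A_periodic: "\<And>t. A (t + N) = A t"
    and C_periodic: "\<And>t. C (t + N) = C t"
    and S_dim: "\<And>k. k < N \<Longrightarrow> S k \<in> carrier_mat (q k) p"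
    and d: "d \<le> n"
    and A1: "\<And>k. k < N \<Longrightarrow> extended_by_identity n d (A k)"
    and A2: "eigenvalues_in_unit_disk (Phi_s N n d A)"
    and A3: "observable n (lifted_output N n A C) (lifted_state N n A)"
    and A4: "\<And>k. k < N \<Longrightarrow> compact_vecs p (output_set p (S k))"
    and eps: "0 < \<epsilon>" "\<epsilon> < 1"
    and H0_dim: "H0 \<in> carrier_mat m n"
    and h0_dim: "h0 \<in> carrier_vec m"
    and Psi_0: "Psi N n p d A C S \<epsilon> 0 = {x \<in> carrier_vec n. H0 *\<^sub>v x \<le> h0}"
  shows "(\<forall>k \<in> {1..N - 1}.
            Psi N n p d A C S \<epsilon> k
              = {x \<in> carrier_vec n. H_mat N n A C S H0 k *\<^sub>v x \<le> h_vec N S h0 k})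
         \<and> (2 \<le> N \<longrightarrow>
              H_mat N n A C S H0 (N - 1) = (S (N - 1) * C (N - 1)) @\<^sub>r (H0 * A (N - 1))
              \<and> h_vec N S h0 (N - 1) = ones (q (N - 1)) @\<^sub>v h0)"
proof (intro conjI ballI impI)
  fix k assume "k \<in> {1..N - 1}"
  then have k: "k \<le> N" by auto
  have "x \<in> Psi N n p d A C S \<epsilon> k \<longleftrightarrow> H_mat N n A C S H0 k *\<^sub>v x \<le> h_vec N S h0 k"
    if x: "x \<in> carrier_vec n" for x
  proof -
    have "transition n A k N *\<^sub>v x \<in> carrier_vec n"
      using transition_carrier[where A = A, OF A_dim k] x by simp
    then show ?thesis
      using Psi_unfold_to_period[where A = A and C = C, OF A_dim A_periodic C_periodic d A1 k x]
        H_mat_le_h_vec_iff[where A = A and C = C and S = S, OF A_dim C_dim S_dim H0_dim h0_dim k x]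
      by (simp add: Psi_0)
  qed
  moreover have "Psi N n p d A C S \<epsilon> k \<subseteq> carrier_vec n"
    by (auto simp: Psi_def Omega_eps_def Omega_def)
  ultimately show "Psi N n p d A C S \<epsilon> k
      = {x \<in> carrier_vec n. H_mat N n A C S H0 k *\<^sub>v x \<le> h_vec N S h0 k}"
    by blast
next
  show "H_mat N n A C S H0 (N - 1) = (S (N - 1) * C (N - 1)) @\<^sub>r (H0 * A (N - 1))"
    using H_mat_last[OF A_dim C_dim N] .
  have "dim_row (S (N - 1)) = q (N - 1)"
    using S_dim[of "N - 1"] N by simp
  then show "h_vec N S h0 (N - 1) = ones (q (N - 1)) @\<^sub>v h0"
    using h_vec_last[OF N] by simp
qed

end
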